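(* For every $0<\varepsilon<1$ there is some $\delta>0$ such that the following holds. Let $k\geq 1$ and let $\Phi$ be a $k$-vertex graph invariant such that \[1\leq|\operatorname{supp}(\Phi)|\leq(2-\varepsilon)^{\binom{k}{2}}.\] Then there is a $k$-vertex graph $H$ such that $\widehat{\Phi}(H)\neq 0$ and $|E(H)|\geq\delta\cdot\binom{k}{2}$.
   Context: All graphs are finite, simple and undirected. A graph invariant is an isomorphism-invariant map $\Phi$ from graphs to $\mathbb{Q}$; it is a $k$-vertex graph invariant if $\Phi(G)=0$ whenever $|V(G)|\neq k$. $\operatorname{supp}(\Phi)$ is the set of graphs with vertex set exactly $\{1,\dots,k\}$ on which $\Phi$ is nonzero. The alternating enumerator of $\Phi$ on a graph $H$ is $\widehat{\Phi}(H)=(-1)^{|E(H)|}\sum_{S\subseteq E(H)}(-1)^{|S|}\Phi(H[S])$, where $H[S]=(V(H),S)$. *)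

theory Defs
  imports Complex_Main
begin

(* A finite graph is a pair (V, E) whose edges are two-element subsets of V.  Vertices are
   natural numbers: every finite graph has an isomorphic copy there, so isomorphism-invariant
   maps are determined by their values on these graphs. *)
type_synonym graph = "nat set \<times> nat set set"

abbreviation verts :: "graph \<Rightarrow> nat set" where
  "verts G \<equiv> fst G"

abbreviation edges :: "graph \<Rightarrow> nat set set" where
  "edges G \<equiv> snd G"

definition is_graph :: "graph \<Rightarrow> bool" where
  "is_graph G \<longleftrightarrow> finite (verts G) \<and> (\<forall>e\<in>edges G. e \<subseteq> verts G \<and> card e = 2)"

definition graph_iso :: "graph \<Rightarrow> graph \<Rightarrow> bool" where
  "graph_iso G H \<longleftrightarrow>
     (\<exists>f. bij_betw f (verts G) (verts H) \<and> (\<lambda>e. f ` e) ` edges G = edges H)"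

(* The type also contains pairs that are not graphs; values there are unconstrained and never
   used below. *)
definition graph_invariant :: "(graph \<Rightarrow> rat) \<Rightarrow> bool" where
  "graph_invariant \<Phi> \<longleftrightarrow>
     (\<forall>G H. is_graph G \<longrightarrow> is_graph H \<longrightarrow> graph_iso G H \<longrightarrow> \<Phi> G = \<Phi> H)"

definition k_vertex_invariant :: "nat \<Rightarrow> (graph \<Rightarrow> rat) \<Rightarrow> bool" where
  "k_vertex_invariant k \<Phi> \<longleftrightarrow>
     graph_invariant \<Phi> \<and> (\<forall>G. is_graph G \<longrightarrow> card (verts G) \<noteq> k \<longrightarrow> \<Phi> G = 0)"

definition supp :: "nat \<Rightarrow> (graph \<Rightarrow> rat) \<Rightarrow> graph set" where
  "supp k \<Phi> = {G. is_graph G \<and> verts G = {1..k} \<and> \<Phi> G \<noteq> 0}"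

definition spanning_subgraph :: "graph \<Rightarrow> nat set set \<Rightarrow> graph" where
  "spanning_subgraph H S = (verts H, S)"

definition alt_enum :: "(graph \<Rightarrow> rat) \<Rightarrow> graph \<Rightarrow> rat" where
  "alt_enum \<Phi> H =
     (-1) ^ card (edges H) *
     (\<Sum>S\<in>Pow (edges H). (-1) ^ card S * \<Phi> (spanning_subgraph H S))"

lemma finite_edges: "is_graph G \<Longrightarrow> finite (edges G)"
  unfolding is_graph_def by (auto intro: finite_subset[of _ "Pow (verts G)"])

lemma finite_supp: "finite (supp k \<Phi>)"
proof (rule finite_subset)
  show "supp k \<Phi> \<subseteq> {{1..k}} \<times> Pow (Pow {1..k})"
    unfolding supp_def is_graph_def by fastforce
qed simp

end

(* Write n for the number of vertex pairs.  The numbers alt_enum Phi H are, up to sign, the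
   coefficients of Phi, read as a multilinear polynomial in the n edge indicators.  A nonzero
   multilinear polynomial of degree d has at least 2^(n-d) nonzeros on the cube {0,1}^n, so
   2^(n-d) <= (2-eps)^n, which gives d >= delta n with delta = 1 - log 2 (2-eps). *)
theory Submission
  imports Defs
begin

lemma sum_Pow_insert:
  fixes g :: "'a set \<Rightarrow> 'b::comm_monoid_add"
  assumes "finite T" and "x \<notin> T"
  shows "(\<Sum>S\<in>Pow (insert x T). g S) = (\<Sum>S\<in>Pow T. g S) + (\<Sum>S\<in>Pow T. g (insert x S))"
proof -
  have "inj_on (insert x) (Pow T)"
    using assms(2) by (auto simp: inj_on_def)
  moreover have "Pow T \<inter> insert x ` Pow T = {}"
    using assms(2) by auto
  ultimately show ?thesis
    using assms(1) by (simp add: Pow_insert sum.union_disjoint sum.reindex)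
qed

text \<open>The subsets \<open>S\<close> and \<open>insert x S\<close> carry opposite signs, so they
  pair up. The coefficient of \<open>f\<close> at \<open>insert x T\<close> thereby becomes a
  coefficient at \<open>T\<close> of a function that no longer involves \<open>x\<close>, ready for
  induction.\<close>

lemma alternating_sum_insert:
  fixes f :: "'a set \<Rightarrow> 'b::comm_ring_1"
  assumes "finite T" and "x \<notin> T"
  shows "(\<Sum>S\<in>Pow (insert x T). (-1) ^ card S * f S) =
    (\<Sum>S\<in>Pow T. (-1) ^ card S * (f S - f (insert x S)))"
proof -
  have "(-1) ^ card (insert x S) * f (insert x S) = - ((-1) ^ card S * f (insert x S))"
    if "S \<in> Pow T" for S
    using that assms finite_subset[of S T] by (subst card_insert_disjoint) auto
  then show ?thesis
    using assms by (simp add: sum_Pow_insert sum_negf right_diff_distrib sum_subtractf)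
qed

text \<open>Induction on the variables: split \<open>f\<close> according to whether its polynomial
  involves \<open>x\<close>. The bound is 2^(n-d) \<le> |support| with d = \<open>card T\<close>,
  multiplied out to avoid subtraction in the exponent.\<close>

lemma small_support_large_coefficient:
  fixes f :: "'a set \<Rightarrow> 'b::comm_ring_1"
  assumes "finite E" and "\<exists>S\<subseteq>E. f S \<noteq> 0"
  shows "\<exists>T\<subseteq>E. (\<Sum>S\<in>Pow T. (-1) ^ card S * f S) \<noteq> 0 \<and>
    2 ^ card E \<le> 2 ^ card T * card {S. S \<subseteq> E \<and> f S \<noteq> 0}"
  using assms
proof (induction E arbitrary: f rule: finite_induct)
  case empty
  then have "{S. S \<subseteq> {} \<and> f S \<noteq> 0} = {{}}" by auto
  with empty show ?case by auto
next
  case (insert x E)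
  define supp_f where "supp_f = {S. S \<subseteq> insert x E \<and> f S \<noteq> 0}"
  have fin: "finite supp_f"
    using insert.hyps by (auto simp: supp_f_def)
  show ?case
  \<comment> \<open>The difference is, up to sign, the coefficient of \<open>x\<close> in
    \<open>f\<close>, a polynomial in the variables of \<open>E\<close>.\<close>
  proof (cases "\<exists>S\<subseteq>E. f S - f (insert x S) \<noteq> 0")
    case True
    define supp_g where "supp_g = {S. S \<subseteq> E \<and> f S - f (insert x S) \<noteq> 0}"
    obtain T where T: "T \<subseteq> E"
      "(\<Sum>S\<in>Pow T. (-1) ^ card S * (f S - f (insert x S))) \<noteq> 0"
      "2 ^ card E \<le> 2 ^ card T * card supp_g"
      using insert.IH[OF True] unfolding supp_g_def by blast
    \<comment> \<open>A nonzero difference forces \<open>f\<close> to be nonzero at \<open>S\<close>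
      or at \<open>insert x S\<close>, and deleting \<open>x\<close> maps both to
      \<open>S\<close>.\<close>
    have "supp_g \<subseteq> (\<lambda>S. S - {x}) ` supp_f"
    proof
      fix S assume S: "S \<in> supp_g"
      then have "S - {x} = S" "insert x S - {x} = S"
        using insert.hyps by (auto simp: supp_g_def)
      moreover have "S \<in> supp_f \<or> insert x S \<in> supp_f"
        using S by (auto simp: supp_g_def supp_f_def)
      ultimately show "S \<in> (\<lambda>S. S - {x}) ` supp_f"
        by (metis image_eqI)
    qed
    then have "card supp_g \<le> card supp_f"
      using fin by (meson card_image_le card_mono finite_imageI le_trans)
    then have "2 ^ card E \<le> 2 ^ card T * card supp_f"
      using T(3) by (meson le_trans mult_le_mono2)
    moreover have "finite T" "x \<notin> T"
      using T(1) insert.hyps finite_subset by auto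
    \<comment> \<open>Adding \<open>x\<close> to both \<open>E\<close> and \<open>T\<close> doubles
      both sides of the bound.\<close>
    ultimately have "insert x T \<subseteq> insert x E \<and>
      (\<Sum>S\<in>Pow (insert x T). (-1) ^ card S * f S) \<noteq> 0 \<and>
      2 ^ card (insert x E) \<le> 2 ^ card (insert x T) * card supp_f"
      using T(1,2) insert.hyps by (auto simp: alternating_sum_insert)
    then show ?thesis
      unfolding supp_f_def by blast
  next
    case False
    \<comment> \<open>Now \<open>f\<close> ignores \<open>x\<close>, so its support is two disjoint
      copies of \<open>A\<close>. This doubling pays for the new variable while \<open>T\<close>
      stays the same.\<close>
    then have eq: "f (insert x S) = f S" if "S \<subseteq> E" for S
      using that by auto
    define A where "A = {S. S \<subseteq> E \<and> f S \<noteq> 0}"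
    have "supp_f = {S \<in> Pow (insert x E). f S \<noteq> 0}"
      by (auto simp: supp_f_def)
    then have split: "supp_f = A \<union> insert x ` A"
      unfolding Pow_insert A_def using eq by auto
    have "A \<noteq> {}"
      using insert.prems split by (auto simp: supp_f_def)
    then obtain T where T: "T \<subseteq> E" "(\<Sum>S\<in>Pow T. (-1) ^ card S * f S) \<noteq> 0"
      "2 ^ card E \<le> 2 ^ card T * card A"
      using insert.IH[of f] unfolding A_def by blast
    have "inj_on (insert x) A" "A \<inter> insert x ` A = {}" "finite A"
      using insert.hyps by (auto simp: A_def inj_on_def)
    then have "card supp_f = 2 * card A"
      unfolding split by (simp add: card_Un_disjoint card_image)
    then have "2 ^ card (insert x E) \<le> 2 ^ card T * card supp_f"
      using T(3) insert.hyps by simp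
    then show ?thesis
      using T(1,2) unfolding supp_f_def by blast
  qed
qed

theorem theorem5p1:
  fixes \<epsilon> :: real
  assumes "0 < \<epsilon>" and "\<epsilon> < 1"
  shows "\<exists>\<delta>::real. \<delta> > 0 \<and>
    (\<forall>(k::nat) \<Phi>. k \<ge> 1 \<longrightarrow> k_vertex_invariant k \<Phi> \<longrightarrow>
       1 \<le> card (supp k \<Phi>) \<longrightarrow>
       real (card (supp k \<Phi>)) \<le> (2 - \<epsilon>) ^ (k choose 2) \<longrightarrow>
       (\<exists>H. is_graph H \<and> card (verts H) = k \<and> alt_enum \<Phi> H \<noteq> 0 \<and>
            real (card (edges H)) \<ge> \<delta> * real (k choose 2)))"
proof (intro exI[of _ "1 - log 2 (2 - \<epsilon>)"] conjI allI impI)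
  let ?\<delta> = "1 - log 2 (2 - \<epsilon>)"
  show "?\<delta> > 0"
    using assms by simp
  fix k :: nat and \<Phi> :: "graph \<Rightarrow> rat"
  assume nonempty: "1 \<le> card (supp k \<Phi>)"
    and small: "real (card (supp k \<Phi>)) \<le> (2 - \<epsilon>) ^ (k choose 2)"
  define E where "E = {e. e \<subseteq> {1..k} \<and> card e = 2}"
  define A where "A = {S. S \<subseteq> E \<and> \<Phi> ({1..k}, S) \<noteq> 0}"
  have "finite E"
    by (simp add: E_def)
  have card_E: "card E = k choose 2"
    unfolding E_def by (subst n_subsets) auto
  \<comment> \<open>With the vertex set fixed, a graph is just its edge set, a point of the cube
    over \<open>E\<close>.\<close>
  have "G \<in> supp k \<Phi> \<longleftrightarrow> fst G = {1..k} \<and> snd G \<in> A" for G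
    by (cases G) (auto simp only: supp_def is_graph_def A_def E_def mem_Collect_eq subset_iff
        fst_conv snd_conv finite_atLeastAtMost)
  then have "supp k \<Phi> = {{1..k}} \<times> A"
    by (intro set_eqI) (simp add: mem_Times_iff)
  then have card_supp: "card (supp k \<Phi>) = card A"
    by (simp add: card_cartesian_product)
  with nonempty have "A \<noteq> {}" by auto
  then have "\<exists>S\<subseteq>E. \<Phi> ({1..k}, S) \<noteq> 0"
    by (auto simp: A_def)
  from small_support_large_coefficient[OF \<open>finite E\<close> this]
  obtain T where T: "T \<subseteq> E" "(\<Sum>S\<in>Pow T. (-1) ^ card S * \<Phi> ({1..k}, S)) \<noteq> 0"
    and bound: "2 ^ card E \<le> 2 ^ card T * card A"
    unfolding A_def by (elim exE conjE)
  let ?n = "k choose 2"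
  have "(2::real) ^ ?n \<le> 2 ^ card T * real (card A)"
    using of_nat_mono[OF bound, where 'a = real] by (simp add: card_E)
  also have "\<dots> \<le> 2 ^ card T * (2 - \<epsilon>) ^ ?n"
    using small card_supp by (intro mult_left_mono) auto
  \<comment> \<open>Taking logarithms makes the bound linear in \<open>card T\<close>; solving for
    it yields the factor \<open>?\<delta>\<close>.\<close>
  finally have "log 2 (2 ^ ?n) \<le> log 2 (2 ^ card T * (2 - \<epsilon>) ^ ?n)"
    using assms by (intro log_mono) auto
  then have "real ?n \<le> real (card T) + real ?n * log 2 (2 - \<epsilon>)"
    using assms by (simp add: log_mult log_nat_power)
  then have large: "?\<delta> * real ?n \<le> real (card T)"
    by (simp add: algebra_simps)
  show "\<exists>H. is_graph H \<and> card (verts H) = k \<and> alt_enum \<Phi> H \<noteq> 0 \<and>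
      real (card (edges H)) \<ge> ?\<delta> * real ?n"
    \<comment> \<open>The sum over \<open>Pow T\<close> differs from \<open>alt_enum\<close> at
      \<open>({1..k}, T)\<close> only by a sign.\<close>
    using T large
    by (intro exI[of _ "({1..k}, T)"])
      (auto simp: is_graph_def E_def alt_enum_def spanning_subgraph_def)
qed

end
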